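(* Let $T\colon[0,1)\to[0,1)$ be an interval exchange transformation and let $\mu$ be a $T$-invariant, $T$-ergodic Borel probability measure on $[0,1)$. Then \[\liminf_{n\to\infty} n\,|T^n(x)-y|=0\quad\text{for } \mu\times\mu\text{-almost every }(x,y)\in[0,1)^2.\]
   Context: An interval exchange transformation (IET) is given by an integer $r\ge2$, a permutation $\pi$ of $\{1,\dots,r\}$ and a vector $(\ell_1,\dots,\ell_r)$ with all $\ell_i>0$ and $\sum\ell_i=1$: with $s_0=0$, $s_k=\sum_{i\le k}\ell_i$ and $I_k=[s_{k-1},s_k)$, one sets $T(x)=x-\sum_{i<k}\ell_i+\sum_{\pi(i')<\pi(k)}\ell_{i'}$ for $x\in I_k$. A measure $\mu$ is $T$-ergodic if every $T$-invariant Borel set has $\mu$-measure $0$ or $1$. *)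

theory Defs
  imports "HOL-Probability.Probability" "HOL-Combinatorics.Permutations"
begin

definition iet_s :: "(nat \<Rightarrow> real) \<Rightarrow> nat \<Rightarrow> real" where
  "iet_s l k = (\<Sum>i\<in>{1..k}. l i)"

definition is_iet :: "nat \<Rightarrow> (nat \<Rightarrow> nat) \<Rightarrow> (nat \<Rightarrow> real) \<Rightarrow> bool" where
  "is_iet r p l \<longleftrightarrow> r \<ge> 2 \<and> p permutes {1..r} \<and> (\<forall>i\<in>{1..r}. l i > 0)
     \<and> (\<Sum>i\<in>{1..r}. l i) = 1"

text \<open>The IET map: for x in I_k = [s_(k-1), s_k),
  T x = x - sum_(i<k) l_i + sum_(p i' < p k) l_i'.  Outside [0,1) it is the identity
  (irrelevant convention).\<close>
definition iet_map :: "nat \<Rightarrow> (nat \<Rightarrow> nat) \<Rightarrow> (nat \<Rightarrow> real) \<Rightarrow> real \<Rightarrow> real" where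
  "iet_map r p l x =
     (if \<exists>k\<in>{1..r}. iet_s l (k - 1) \<le> x \<and> x < iet_s l k then
        (let k = (THE k. k \<in> {1..r} \<and> iet_s l (k - 1) \<le> x \<and> x < iet_s l k) in
           x - iet_s l (k - 1) + (\<Sum>i\<in>{i\<in>{1..r}. p i < p k}. l i))
      else x)"

definition invariant_measure :: "real measure \<Rightarrow> (real \<Rightarrow> real) \<Rightarrow> bool" where
  "invariant_measure M T \<longleftrightarrow> T \<in> measurable M M \<and> distr M M T = M"

definition ergodic_measure :: "real measure \<Rightarrow> (real \<Rightarrow> real) \<Rightarrow> bool" where
  "ergodic_measure M T \<longleftrightarrow>
     (\<forall>A\<in>sets M. T -` A \<inter> space M = A \<longrightarrow> measure M A = 0 \<or> measure M A = 1)"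

end

theory Submission
  imports Defs
begin

text \<open>
  The function \<open>f x y = liminf n \<bar>T\<^sup>n x - y\<bar>\<close> does not increase under \<open>x \<mapsto> T x\<close>, nor under
  \<open>y \<mapsto> T y\<close> unless \<open>y\<close> is a discontinuity, so by ergodicity each set \<open>{f \<le> 1/m}\<close> is null or
  conull. To see that it is not null (when there are no atoms), take an initial segment \<open>[0,b)\<close> of
  small positive measure. Its first return map is a piecewise translation with a number of pieces
  bounded independently of \<open>b\<close>, and the towers over these pieces fill the space, so one tower
  has measure bounded below. If \<open>n\<close> is its height, its base has length at most \<open>1/n\<close>, since the
  levels are disjoint translates in \<open>[0,1)\<close>; some part \<open>Q\<close> of the base of length less than
  \<open>1/(n m)\<close> still carries a tower of measure bounded below. For \<open>x\<close> in the first third and \<open>y\<close>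
  in the last third of this tower, some \<open>T\<^sup>k x\<close> with \<open>n/3 \<lesssim> k \<le> n\<close> lies in the same level as \<open>y\<close>,
  whence \<open>k \<bar>T\<^sup>k x - y\<bar> < 1/m\<close>. As \<open>b \<rightarrow> 0\<close> the height tends to infinity while the measure of this set
  of pairs stays bounded below. If there is an atom, the measure lives on a periodic orbit.
\<close>

text \<open>An interval exchange enters only as an injective map that is a translation between
  finitely many break points. The half-open \<open>{u<..v}\<close> encodes continuity from the
  right: a break point may be the left end of a stretch, but may not lie further right in
  it.\<close>

locale ergodic_piecewise_translation = prob_space M for M :: "real measure" +
  fixes T :: "real \<Rightarrow> real" and D :: "real set"
  assumes sets_M: "sets M = sets (restrict_space borel {0..<1::real})"
    and invariant: "invariant_measure M T"
    and ergodic: "ergodic_measure M T"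
    and inj_T: "inj_on T {0..<1}"
    and finite_D: "finite D"
    and translation:
      "\<And>u v. 0 \<le> u \<Longrightarrow> u \<le> v \<Longrightarrow> v < 1 \<Longrightarrow> D \<inter> {u<..v} = {} \<Longrightarrow> T v = T u + (v - u)"
begin

subsection \<open>The measure-preserving system\<close>

lemma space_M: "space M = {0..<1}"
  using sets_eq_imp_space_eq[OF sets_M] by (simp add: space_restrict_space)

lemma sets_M_iff: "A \<in> sets M \<longleftrightarrow> A \<subseteq> {0..<1} \<and> A \<in> sets borel"
  unfolding sets_M by (subst sets_restrict_space_iff) auto

lemma T_measurable [measurable]: "T \<in> measurable M M"
  using invariant by (simp add: invariant_measure_def)

lemma funpow_measurable [measurable]: "(T ^^ n) \<in> measurable M M"
  by (rule measurable_compose_n) simp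

lemma id_borel_measurable [measurable]: "(\<lambda>x. x) \<in> borel_measurable M"
  by (rule measurableI) (auto simp: sets_M_iff space_M)

lemma distr_funpow: "distr M M (T ^^ n) = M"
proof (induction n)
  case 0
  have "distr M M (\<lambda>x. x) = M" by (rule distr_id)
  then show ?case by (simp add: id_def)
next
  case (Suc n)
  have "distr M M (T ^^ Suc n) = distr (distr M M (T ^^ n)) M T"
    by (subst distr_distr) auto
  then show ?case
    using Suc invariant by (simp only: invariant_measure_def)
qed

lemma measure_vimage_funpow:
  "A \<in> sets M \<Longrightarrow> measure M ((T ^^ n) -` A \<inter> space M) = measure M A"
  using measure_distr[OF funpow_measurable, of A n] by (simp add: distr_funpow)

lemma AE_funpow:
  assumes "AE x in M. P x"
  shows "AE x in M. P ((T ^^ n) x)"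
proof (rule AE_distrD[OF funpow_measurable])
  show "AE x in distr M M (T ^^ n). P x" using assms by (subst distr_funpow)
qed

lemma funpow_in: "x \<in> {0..<1} \<Longrightarrow> (T ^^ n) x \<in> {0..<1}"
  using measurable_space[OF funpow_measurable] by (simp add: space_M)

lemma inj_funpow: "inj_on (T ^^ n) {0..<1}"
proof (induction n)
  case (Suc n)
  have "inj_on (T \<circ> (T ^^ n)) {0..<1}"
    by (rule comp_inj_on[OF Suc inj_on_subset[OF inj_T]]) (use funpow_in in blast)
  then show ?case by (simp only: funpow.simps)
qed simp

lemma funpow_cancel:
  assumes "x \<in> {0..<1}" "y \<in> {0..<1}" "(T ^^ i) x = (T ^^ j) y" "i \<le> j"
  shows "x = (T ^^ (j - i)) y"
proof -
  have "(T ^^ i) x = (T ^^ i) ((T ^^ (j - i)) y)"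
    using assms(3,4) by (metis comp_apply funpow_add le_add_diff_inverse)
  then show ?thesis
    using inj_onD[OF inj_funpow] assms(1,2) funpow_in by blast
qed

text \<open>The hypothesis \<open>ergodic\<close> speaks of exactly invariant sets only. The set
  \<open>F\<close> of points whose orbit eventually stays in \<open>A\<close> is exactly invariant
  and contains almost all of \<open>A\<close>, so it has measure 1. Conversely \<open>E N\<close>
  lies in the preimage of \<open>A\<close> under \<open>T ^^ N\<close>, so \<open>F\<close> has no
  more mass than \<open>A\<close>.\<close>

lemma forward_invariant_imp_full:
  assumes A [measurable]: "A \<in> sets M" and fwd: "AE x in M. x \<in> A \<longrightarrow> T x \<in> A"
    and pos: "measure M A > 0"
  shows "measure M A = 1"
proof -
  define E where "E N = {x \<in> space M. \<forall>n\<ge>N. (T ^^ n) x \<in> A}" for N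
  have E_meas [measurable]: "E N \<in> sets M" for N
    unfolding E_def by measurable
  define F where "F = (\<Union>N. E N)"
  have F_meas [measurable]: "F \<in> sets M"
    unfolding F_def by measurable
  have "T -` F \<inter> space M = F"
  proof (intro set_eqI iffI)
    fix x assume "x \<in> T -` F \<inter> space M"
    then obtain N where x: "x \<in> space M" and "\<forall>n\<ge>N. (T ^^ n) (T x) \<in> A"
      by (auto simp: F_def E_def)
    then have N: "(T ^^ Suc n) x \<in> A" if "n \<ge> N" for n
      using that by (simp add: funpow_swap1)
    have "(T ^^ n) x \<in> A" if "n \<ge> Suc N" for n
      using N[of "n - 1"] that by (cases n) auto
    with x show "x \<in> F" by (auto simp: F_def E_def)
  next
    fix x assume "x \<in> F"
    then obtain N where x: "x \<in> space M" and N: "\<forall>n\<ge>N. (T ^^ n) x \<in> A"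
      by (auto simp: F_def E_def)
    have "(T ^^ n) (T x) \<in> A" if "n \<ge> N" for n
      using N[rule_format, of "Suc n"] that by (simp add: funpow_swap1)
    with x show "x \<in> T -` F \<inter> space M"
      using measurable_space[OF T_measurable] by (auto simp: F_def E_def)
  qed
  then have F01: "measure M F = 0 \<or> measure M F = 1"
    using ergodic by (simp add: ergodic_measure_def)
  have "AE x in M. \<forall>n. (T ^^ n) x \<in> A \<longrightarrow> (T ^^ Suc n) x \<in> A"
    using AE_funpow[OF fwd] by (subst AE_all_countable) simp
  then have "AE x in M. x \<in> A \<longrightarrow> x \<in> F"
  proof eventually_elim
    case (elim x)
    show ?case
    proof
      assume "x \<in> A"
      have "(T ^^ n) x \<in> A" for n
        by (induction n) (use elim \<open>x \<in> A\<close> in auto)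
      moreover have "x \<in> space M" using \<open>x \<in> A\<close> sets.sets_into_space[OF A] by auto
      ultimately show "x \<in> F" by (auto simp: F_def E_def)
    qed
  qed
  then have "measure M A \<le> measure M F"
    by (intro finite_measure_mono_AE) auto
  with F01 pos have "measure M F = 1" by linarith
  have "(\<lambda>N. measure M (E N)) \<longlonglongrightarrow> measure M F"
    unfolding F_def by (intro finite_Lim_measure_incseq) (auto simp: incseq_def E_def)
  moreover have "measure M (E N) \<le> measure M A" for N
  proof -
    have "measure M (E N) \<le> measure M ((T ^^ N) -` A \<inter> space M)"
      by (intro finite_measure_mono) (auto simp: E_def)
    then show ?thesis by (simp add: measure_vimage_funpow)
  qed
  ultimately have "measure M F \<le> measure M A"
    by (intro LIMSEQ_le_const2) auto
  then show ?thesis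
    using \<open>measure M F = 1\<close> prob_le_1[of A] by linarith
qed

subsection \<open>First-return towers over an initial segment\<close>

text \<open>A preimage of \<open>b\<close> is listed with the break points because an image interval
  straddling \<open>b\<close> separates returned points from those still outside
  \<open>[0,b)\<close>.\<close>

definition cutters :: "real \<Rightarrow> real set" where
  "cutters b = D \<union> {z \<in> {0..<1}. T z = b}"

text \<open>For a starting point in \<open>[0,b)\<close> this says that the first return comes after
  time \<open>i\<close>. Time 0 is left out because the starting point itself lies in the
  segment.\<close>

definition avoids :: "real \<Rightarrow> real \<Rightarrow> nat \<Rightarrow> bool" where
  "avoids b x i \<longleftrightarrow> (\<forall>j\<in>{1..i}. b \<le> (T ^^ j) x)"

text \<open>The points at which the first return to \<open>[0,b)\<close> can fail to be a local translation; at most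
  one arises from each cutter, because \<open>T\<close> is injective.\<close>

definition cuts :: "real \<Rightarrow> real set" where
  "cuts b = {c \<in> {0..<b}. \<exists>i. avoids b c i \<and> (T ^^ i) c \<in> cutters b}"

text \<open>For \<open>c\<close> in \<open>insert 0 (cuts b)\<close> this is the stretch of
  \<open>[0,b)\<close> from \<open>c\<close> up to, but excluding, the next cut.\<close>

definition piece :: "real \<Rightarrow> real \<Rightarrow> real set" where
  "piece b c = {x \<in> {0..<b}. c \<le> x \<and> cuts b \<inter> {c<..x} = {}}"

section \<open>Bounding the number of cuts independently of \<open>b\<close>\<close>

lemma cutters_card: "finite (cutters b)" "card (cutters b) \<le> card D + 1"
proof -
  have "\<exists>z. {z \<in> {0..<1}. T z = b} \<subseteq> {z}"
  proof (cases "\<exists>z\<in>{0..<1}. T z = b")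
    case True
    then obtain z where "z \<in> {0..<1}" "T z = b" by blast
    then have "{z \<in> {0..<1}. T z = b} \<subseteq> {z}"
      using inj_onD[OF inj_T] by blast
    then show ?thesis ..
  qed blast
  then obtain z where "{z \<in> {0..<1}. T z = b} \<subseteq> {z}" ..
  then have sub: "cutters b \<subseteq> insert z D"
    by (auto simp: cutters_def)
  then show "finite (cutters b)"
    using finite_D finite_subset by blast
  have "card (cutters b) \<le> card (insert z D)"
    using sub finite_D by (intro card_mono) auto
  also have "\<dots> \<le> card D + 1" by (simp add: finite_D card_insert_if)
  finally show "card (cutters b) \<le> card D + 1" .
qed

text \<open>Sending each cut to a cutter that it hits before returning is injective: if
  \<open>c\<close> and \<open>c'\<close> reach the same cutter at times
  \<open>t c \<le> t c'\<close>, cancelling \<open>t c\<close> steps puts \<open>c\<close> on the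
  orbit of \<open>c'\<close>. If the points differ, \<open>c'\<close> would have returned to
  \<open>[0,b)\<close> too early.\<close>

lemma cuts_card:
  assumes "b \<le> 1"
  shows "finite (cuts b)" "card (cuts b) \<le> card D + 1"
proof -
  have "\<forall>c\<in>cuts b. \<exists>i. avoids b c i \<and> (T ^^ i) c \<in> cutters b"
    by (auto simp: cuts_def)
  then obtain t where t: "\<And>c. c \<in> cuts b \<Longrightarrow> avoids b c (t c)"
      "\<And>c. c \<in> cuts b \<Longrightarrow> (T ^^ t c) c \<in> cutters b"
    by metis
  have *: "c = c'" if c: "c \<in> cuts b" "c' \<in> cuts b" "(T ^^ t c) c = (T ^^ t c') c'" "t c \<le> t c'" for c c'
  proof (rule ccontr)
    assume "c \<noteq> c'"
    have in01: "c \<in> {0..<b}" "c \<in> {0..<1}" "c' \<in> {0..<1}"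
      using c assms by (auto simp: cuts_def)
    then have eq: "c = (T ^^ (t c' - t c)) c'"
      using funpow_cancel c by blast
    with \<open>c \<noteq> c'\<close> have "t c' - t c \<noteq> 0" by (metis funpow_0)
    then have "b \<le> (T ^^ (t c' - t c)) c'"
      using t(1)[OF c(2)] by (auto simp: avoids_def)
    with eq in01 show False by auto
  qed
  have inj: "inj_on (\<lambda>c. (T ^^ t c) c) (cuts b)"
    by (rule inj_onI) (metis * nat_le_linear)
  have sub: "(\<lambda>c. (T ^^ t c) c) ` cuts b \<subseteq> cutters b"
    using t(2) by auto
  show "finite (cuts b)"
    using inj_on_finite[OF inj sub cutters_card(1)] .
  show "card (cuts b) \<le> card D + 1"
    using card_inj_on_le[OF inj sub cutters_card(1)] cutters_card(2) by (rule order_trans)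
qed

section \<open>Pieces move rigidly until the first return\<close>

lemma avoids_Suc: "avoids b x (Suc i) \<longleftrightarrow> avoids b x i \<and> b \<le> (T ^^ Suc i) x"
proof -
  have "{1..Suc i} = insert (Suc i) {1..i}" by auto
  then show ?thesis unfolding avoids_def by (simp only: ball_simps) blast
qed

lemma avoids_mono: "avoids b x j \<Longrightarrow> i \<le> j \<Longrightarrow> avoids b x i"
  by (auto simp: avoids_def)

text \<open>A single point \<open>w0\<close> that has not returned forces the same for all of
  \<open>[u,v]\<close>. Rigidity can fail only at a break point inside the image interval, and
  simultaneous avoidance only when the image crosses \<open>b\<close>. Either event puts a cutter
  into the image of \<open>(u,v]\<close>, and its pull-back would be a forbidden cut.\<close>

lemma translation_until_return:
  assumes uv: "0 \<le> u" "u \<le> v" "v < b" "b \<le> 1" and free: "cuts b \<inter> {u<..v} = {}"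
    and w0: "w0 \<in> {u..v}" "avoids b w0 i" and w: "w \<in> {u..v}"
  shows "(T ^^ i) w = (T ^^ i) u + (w - u) \<and> avoids b w i"
  using w0(2) w
proof (induction i arbitrary: w)
  case 0
  then show ?case by (simp add: avoids_def)
next
  case (Suc i)
  have "avoids b w0 i" using Suc.prems(1) avoids_Suc by blast
  then have IH: "(T ^^ i) w = (T ^^ i) u + (w - u)" "avoids b w i" if "w \<in> {u..v}" for w
    using Suc.IH that by blast+
  have no_cutter: "cutters b \<inter> {(T ^^ i) u<..(T ^^ i) v} = {}"
  proof (rule ccontr)
    assume "\<not> ?thesis"
    then obtain d where d: "d \<in> cutters b" "(T ^^ i) u < d" "d \<le> (T ^^ i) v" by auto
    define z where "z = u + (d - (T ^^ i) u)"
    have z: "u < z" "z \<le> v" using d IH(1)[of v] uv by (auto simp: z_def)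
    then have "(T ^^ i) z = d" "avoids b z i"
      using IH[of z] by (auto simp: z_def)
    then have "z \<in> cuts b" using d z uv by (auto simp: cuts_def)
    then show False using free z by auto
  qed
  have step: "(T ^^ Suc i) w = (T ^^ Suc i) u + (w - u)" if "w \<in> {u..v}" for w
  proof -
    have "T ((T ^^ i) w) = T ((T ^^ i) u) + ((T ^^ i) w - (T ^^ i) u)"
    proof (rule translation)
      show "0 \<le> (T ^^ i) u" using funpow_in[of u i] uv by auto
      show "(T ^^ i) w < 1" using funpow_in[of w i] uv that by auto
      show "(T ^^ i) u \<le> (T ^^ i) w" using IH(1)[OF that] that by auto
      show "D \<inter> {(T ^^ i) u<..(T ^^ i) w} = {}"
        using no_cutter IH(1)[OF that] IH(1)[of v] that uv by (fastforce simp: cutters_def)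
    qed
    then show ?thesis using IH(1)[OF that] by simp
  qed
  \<comment> \<open>If \<open>w\<close> has returned and \<open>w0\<close> has not, the translated
    image passes through \<open>b\<close> at a point \<open>z\<close> of \<open>(w,w0]\<close>, and
    then \<open>(T ^^ i) z\<close> is a cutter.\<close>
  have "b \<le> (T ^^ Suc i) w"
  proof (rule ccontr)
    assume less: "\<not> ?thesis"
    have ge: "b \<le> (T ^^ Suc i) w0" using Suc.prems by (simp add: avoids_Suc)
    define z where "z = w + (b - (T ^^ Suc i) w)"
    have z: "w < z" "z \<le> w0"
      using less ge step[OF Suc.prems(2)] step[OF w0(1)] unfolding z_def by linarith+
    then have zin: "z \<in> {u..v}" using Suc.prems w0(1) by auto
    have "(T ^^ Suc i) z = b"
      using step[OF zin] step[OF Suc.prems(2)] unfolding z_def by linarith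
    moreover have "(T ^^ i) z \<in> {0..<1}" using funpow_in[of z i] zin uv by auto
    ultimately have "(T ^^ i) z \<in> cutters b" by (auto simp: cutters_def)
    moreover have "(T ^^ i) u < (T ^^ i) z" "(T ^^ i) z \<le> (T ^^ i) v"
      using IH(1)[OF zin] IH(1)[of v] z zin Suc.prems(2) uv by auto
    ultimately show False using no_cutter by auto
  qed
  with step[OF Suc.prems(2)] IH(2)[OF Suc.prems(2)] show ?case
    unfolding avoids_Suc by blast
qed

lemma piece_subset: "piece b c \<subseteq> {0..<b}"
  by (auto simp: piece_def)

lemma piece_interval: "is_interval (piece b c)"
  unfolding is_interval_1 piece_def by fastforce

lemma piece_cover:
  assumes "b \<le> 1"
  shows "(\<Union>c\<in>insert 0 (cuts b). piece b c) = {0..<b}"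
proof (intro equalityI subsetI)
  fix x assume x: "x \<in> {0..<b}"
  \<comment> \<open>The piece containing \<open>x\<close> starts at the last cut not exceeding
    \<open>x\<close>; adding 0 takes care of points before the first cut.\<close>
  define C where "C = {c \<in> insert 0 (cuts b). c \<le> x}"
  have C: "finite C" "C \<noteq> {}"
    using cuts_card(1)[OF assms] x by (auto simp: C_def)
  have Max: "Max C \<in> insert 0 (cuts b)" "Max C \<le> x"
    using Max_in[OF C] by (auto simp: C_def)
  have "cuts b \<inter> {Max C<..x} = {}"
  proof (rule ccontr)
    assume "\<not> ?thesis"
    then obtain c where "c \<in> cuts b" "Max C < c" "c \<le> x" by auto
    then show False using Max_ge[OF C(1), of c] by (auto simp: C_def)
  qed
  with Max x show "x \<in> (\<Union>c\<in>insert 0 (cuts b). piece b c)"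
    unfolding piece_def by blast
qed (auto simp: piece_def)

lemma piece_translation:
  assumes b: "b \<le> 1" and xy: "x \<in> piece b c" "y \<in> piece b c"
    and w: "w \<in> piece b c" "avoids b w i"
  shows "(T ^^ i) y = (T ^^ i) x + (y - x)" "avoids b x i"
proof -
  define u v where "u = min w (min x y)" and "v = max w (max x y)"
  have uv: "u \<in> piece b c" "v \<in> piece b c"
    using xy w by (auto simp: u_def v_def min_def max_def)
  have rng: "w \<in> {u..v}" "x \<in> {u..v}" "y \<in> {u..v}"
    by (auto simp: u_def v_def)
  have free: "cuts b \<inter> {u<..v} = {}"
    using uv by (fastforce simp: piece_def)
  have "0 \<le> u" "u \<le> v" "v < b" using uv rng by (auto simp: piece_def)
  note * = translation_until_return[OF this b free rng(1) w(2)]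
  show "(T ^^ i) y = (T ^^ i) x + (y - x)" "avoids b x i"
    using *[OF rng(2)] *[OF rng(3)] by auto
qed

section \<open>Towers of large measure over short bases\<close>

lemma interval_translate:
  assumes P: "is_interval P" "P \<subseteq> {0..<1}"
    and rigid: "\<And>x y. x \<in> P \<Longrightarrow> y \<in> P \<Longrightarrow> (T ^^ i) y = (T ^^ i) x + (y - x)"
  shows "(T ^^ i) ` P \<in> sets M" "measure M ((T ^^ i) ` P) = measure M P"
proof -
  show *: "(T ^^ i) ` P \<in> sets M"
  proof (cases "P = {}")
    case False
    then obtain x where x: "x \<in> P" by auto
    have "(T ^^ i) ` P = (\<lambda>y. ((T ^^ i) x - x) + y) ` P"
      by (intro image_cong refl) (use rigid[OF x] in auto)
    then have "is_interval ((T ^^ i) ` P)"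
      using P(1) is_interval_translation by metis
    then show ?thesis
      using P(2) funpow_in by (auto simp: sets_M_iff intro!: real_interval_borel_measurable)
  qed simp
  \<comment> \<open>By injectivity the preimage of the image is \<open>P\<close> itself, so
    invariance of the measure applies.\<close>
  have "(T ^^ i) -` ((T ^^ i) ` P) \<inter> space M = P"
    unfolding space_M using inj_on_image_mem_iff[OF inj_funpow _ P(2), of _ i] P(2) by blast
  then show "measure M ((T ^^ i) ` P) = measure M P"
    using measure_vimage_funpow[OF *, of i] by simp
qed

text \<open>The columns over all pieces, each continued until its return, form a forward invariant
  set containing \<open>[0,b)\<close>, which is full by ergodicity. There are at most
  \<open>card D + 2\<close> columns, so one of them carries a definite share of the mass.\<close>

lemma exists_tower:
  assumes b: "b \<le> 1" and pos: "measure M {0..<b} > 0"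
  obtains P n where "is_interval P" "P \<subseteq> {0..<b}"
    "\<And>i x y. i < n \<Longrightarrow> x \<in> P \<Longrightarrow> y \<in> P \<Longrightarrow> (T ^^ i) y = (T ^^ i) x + (y - x)"
    "disjoint_family_on (\<lambda>i. (T ^^ i) ` P) {..<n}"
    "1 / (2 * (real (card D) + 2)) \<le> real n * measure M P"
proof -
  define C where "C = insert 0 (cuts b)"
  have finC: "finite C" and cardC: "card C \<le> card D + 2"
    using cuts_card[OF b] by (auto simp: C_def card_insert_if)
  define live where "live c i \<longleftrightarrow> (\<exists>w\<in>piece b c. avoids b w i)" for c i
  define L where "L c i = (if live c i then (T ^^ i) ` piece b c else {})" for c i
  have rigid: "(T ^^ i) y = (T ^^ i) x + (y - x)"
    if "live c i" "x \<in> piece b c" "y \<in> piece b c" for c i x y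
    using that piece_translation(1)[OF b] unfolding live_def by blast
  have P01: "piece b c \<subseteq> {0..<1}" for c using piece_subset[of b c] b by auto
  have L_sets [measurable]: "L c i \<in> sets M" for c i
    using interval_translate(1)[OF piece_interval P01 rigid[of c i]] by (simp add: L_def)
  have L_measure: "measure M (L c i) \<le> measure M (piece b c)" for c i
    using interval_translate(2)[OF piece_interval P01 rigid[of c i]] by (simp add: L_def)
  \<comment> \<open>Columns are truncated at height \<open>N\<close>, since no bound on the return
    times is available at this point; continuity from below recovers more than half of the
    mass.\<close>
  define V where "V N = (\<Union>c\<in>C. \<Union>i<N. L c i)" for N
  define W where "W = (\<Union>N. V N)"
  have V_sets [measurable]: "V N \<in> sets M" for N
    unfolding V_def using finC by (intro sets.finite_UN) auto
  have W_sets [measurable]: "W \<in> sets M"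
    unfolding W_def by measurable
  have W_iff: "x \<in> W \<longleftrightarrow> (\<exists>c\<in>C. \<exists>i. x \<in> L c i)" for x
    unfolding W_def V_def by auto
  have base: "{0..<b} \<subseteq> W"
  proof
    fix x assume "x \<in> {0..<b}"
    then obtain c where c: "c \<in> C" "x \<in> piece b c" using piece_cover[OF b] unfolding C_def by blast
    then have "live c 0" by (auto simp: live_def avoids_def)
    then have "x \<in> L c 0" using c by (simp add: L_def)
    with c show "x \<in> W" unfolding W_iff by blast
  qed
  have fwd: "T x \<in> W" if "x \<in> W" for x
  proof -
    from that obtain c i where c: "c \<in> C" "x \<in> L c i" unfolding W_iff by blast
    then have li: "live c i" by (auto simp: L_def split: if_splits)
    with c obtain w where w: "w \<in> piece b c" "x = (T ^^ i) w" by (auto simp: L_def)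
    have "avoids b w i" using li piece_translation(2)[OF b w(1) w(1)] unfolding live_def by blast
    have Tx: "T x = (T ^^ Suc i) w" using w by simp
    \<comment> \<open>The image either climbs to the next level of its column or has fallen below
      \<open>b\<close>, that is, back into the base.\<close>
    show ?thesis
    proof (cases "b \<le> T x")
      case True
      with \<open>avoids b w i\<close> Tx have "live c (Suc i)"
        unfolding live_def avoids_Suc using w(1) by metis
      then have "T x \<in> L c (Suc i)" using Tx w(1) unfolding L_def by auto
      with c show ?thesis unfolding W_iff by blast
    next
      case False
      moreover have "T x \<in> {0..<1}" using Tx funpow_in w(1) P01 by (metis subsetD)
      ultimately show ?thesis using base by auto
    qed
  qed
  have "measure M {0..<b} \<le> measure M W"
    using base by (intro finite_measure_mono) auto
  then have "measure M W = 1"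
    using forward_invariant_imp_full[OF W_sets] fwd pos by auto
  moreover have "(\<lambda>N. measure M (V N)) \<longlonglongrightarrow> measure M W"
    unfolding W_def
  proof (rule finite_Lim_measure_incseq)
    show "incseq V"
      unfolding incseq_def V_def by (intro allI impI UN_mono) auto
  qed (use V_sets in blast)
  ultimately have "\<forall>\<^sub>F N in sequentially. measure M (V N) > 1/2"
    by (intro order_tendstoD) auto
  then obtain N where N: "measure M (V N) > 1/2"
    using eventually_happens'[OF sequentially_bot] by blast
  define K where "K = real (card D) + 2"
  have K: "K > 0" by (simp add: K_def)
  \<comment> \<open>Pigeonhole: at most \<open>K\<close> columns share a mass exceeding 1/2.\<close>
  have "\<exists>c\<in>C. 1 / (2 * K) \<le> measure M (\<Union>i<N. L c i)"
  proof (rule ccontr)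
    assume "\<not> ?thesis"
    then have less: "measure M (\<Union>i<N. L c i) \<le> 1 / (2 * K)" if "c \<in> C" for c
      using that by force
    have "measure M (V N) \<le> (\<Sum>c\<in>C. measure M (\<Union>i<N. L c i))"
      unfolding V_def using finC by (intro finite_measure_subadditive_finite) auto
    also have "\<dots> \<le> (\<Sum>c\<in>C. 1 / (2 * K))"
      by (intro sum_mono less)
    also have "\<dots> = real (card C) * (1 / (2 * K))" by simp
    also have "\<dots> \<le> K * (1 / (2 * K))"
      using cardC K by (intro mult_right_mono) (auto simp: K_def)
    also have "\<dots> = 1/2" using K by simp
    finally show False using N by simp
  qed
  then obtain c where c: "1 / (2 * K) \<le> measure M (\<Union>i<N. L c i)" by blast
  \<comment> \<open>The height is the first time at which the column dies, or the truncation
    \<open>N\<close> if it survives that long. Levels from \<open>n\<close> on are empty or cut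
    off.\<close>
  define n where "n = (LEAST i. i = N \<or> \<not> live c i)"
  have live: "live c i" if "i < n" for i
    using not_less_Least[of i "\<lambda>i. i = N \<or> \<not> live c i"] that by (auto simp: n_def)
  have n: "n = N \<or> \<not> live c n"
    unfolding n_def by (rule LeastI[of _ N]) simp
  have "(\<Union>i<N. L c i) \<subseteq> (\<Union>i<n. L c i)"
  proof (cases "n = N")
    case False
    then have "\<not> live c n" using n by simp
    then have "\<not> live c i" if "n \<le> i" for i
      using that avoids_mono unfolding live_def by blast
    then have "L c i = {}" if "n \<le> i" for i
      using that by (simp add: L_def)
    then show ?thesis using not_le_imp_less by blast
  qed simp
  then have "measure M (\<Union>i<N. L c i) \<le> measure M (\<Union>i<n. L c i)"
    by (intro finite_measure_mono) auto
  also have "\<dots> \<le> (\<Sum>i<n. measure M (L c i))"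
    by (intro finite_measure_subadditive_finite) auto
  also have "\<dots> \<le> real n * measure M (piece b c)"
    using sum_bounded_above[of "{..<n}" "\<lambda>i. measure M (L c i)"] L_measure by simp
  finally have big: "1 / (2 * K) \<le> real n * measure M (piece b c)" using c by simp
  \<comment> \<open>Two meeting levels would, after cancelling \<open>i\<close> steps, bring
    \<open>y\<close> back to the point \<open>x\<close> of the base before its return time.\<close>
  have noreturn: "(T ^^ i) x \<noteq> (T ^^ j) y"
    if "i < j" "j < n" "x \<in> piece b c" "y \<in> piece b c" for i j x y
  proof
    assume "(T ^^ i) x = (T ^^ j) y"
    then have "x = (T ^^ (j - i)) y"
      using funpow_cancel that P01 by (meson less_imp_le subsetD)
    moreover have "avoids b y j"
      using live[OF that(2)] piece_translation(2)[OF b that(4) that(4)] unfolding live_def by blast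
    then have "b \<le> (T ^^ (j - i)) y" using that by (auto simp: avoids_def)
    ultimately show False using that piece_subset[of b c] by auto
  qed
  have "disjoint_family_on (\<lambda>i. (T ^^ i) ` piece b c) {..<n}"
  proof (unfold disjoint_family_on_def, intro ballI impI)
    fix i j assume ij: "i \<in> {..<n}" "j \<in> {..<n}" "i \<noteq> j"
    then consider "i < j" "j < n" | "j < i" "i < n" by fastforce
    then show "(T ^^ i) ` piece b c \<inter> (T ^^ j) ` piece b c = {}"
    proof cases
      case 1
      then show ?thesis using noreturn[OF 1] by blast
    next
      case 2
      then show ?thesis using noreturn[OF 2] by (subst Int_commute) blast
    qed
  qed
  from that[OF piece_interval piece_subset rigid[OF live] this] big show thesis
    by (simp add: K_def)
qed

text \<open>Here Lebesgue measure is used instead of \<open>M\<close>: the levels contain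
  \<open>n\<close> disjoint translates of \<open>[u,v]\<close> inside the unit interval.\<close>

lemma tower_area:
  assumes P: "is_interval P" "P \<subseteq> {0..<1}"
    and rigid: "\<And>i x y. i < n \<Longrightarrow> x \<in> P \<Longrightarrow> y \<in> P \<Longrightarrow> (T ^^ i) y = (T ^^ i) x + (y - x)"
    and disj: "disjoint_family_on (\<lambda>i. (T ^^ i) ` P) {..<n}"
    and uv: "u \<in> P" "v \<in> P" "u \<le> v"
  shows "real n * (v - u) \<le> 1"
proof -
  define A where "A i = {(T ^^ i) u..(T ^^ i) v}" for i
  have A_sub: "A i \<subseteq> (T ^^ i) ` P" if "i < n" for i
  proof
    fix z assume z: "z \<in> A i"
    define w where "w = u + (z - (T ^^ i) u)"
    have "u \<le> w" "w \<le> v" using z rigid[OF that uv(1,2)] by (auto simp: w_def A_def)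
    then have "w \<in> P" using P(1) uv unfolding is_interval_1 by blast
    moreover have "z = (T ^^ i) w" using rigid[OF that uv(1) \<open>w \<in> P\<close>] by (simp add: w_def)
    ultimately show "z \<in> (T ^^ i) ` P" by blast
  qed
  have "disjoint_family_on A {..<n}"
  proof (unfold disjoint_family_on_def, intro ballI impI)
    fix i j assume ij: "i \<in> {..<n}" "j \<in> {..<n}" "i \<noteq> j"
    then have "(T ^^ i) ` P \<inter> (T ^^ j) ` P = {}"
      using disj by (rule_tac disjoint_family_onD)
    with A_sub[of i] A_sub[of j] ij show "A i \<inter> A j = {}" by auto
  qed
  then have "measure lborel (\<Union>i<n. A i) = (\<Sum>i<n. measure lborel (A i))"
  proof (intro measure_finite_Union)
    show "emeasure lborel (A i) \<noteq> \<infinity>" for i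
      unfolding A_def emeasure_lborel_Icc_eq by simp
    show "A ` {..<n} \<subseteq> sets lborel" by (auto simp: A_def)
  qed auto
  also have "\<dots> = (\<Sum>i<n. v - u)"
  proof (intro sum.cong refl)
    fix i assume "i \<in> {..<n}"
    then show "measure lborel (A i) = v - u"
      using rigid[OF _ uv(1,2), of i] uv(3) by (simp add: A_def)
  qed
  finally have "real n * (v - u) = measure lborel (\<Union>i<n. A i)" by simp
  also have "\<dots> \<le> measure lborel {0..1::real}"
  proof (rule measure_mono_fmeasurable)
    show "(\<Union>i<n. A i) \<subseteq> {0..1}"
    proof
      fix z assume "z \<in> (\<Union>i<n. A i)"
      then obtain i w where "z = (T ^^ i) w" "w \<in> P" using A_sub by blast
      then show "z \<in> {0..1}" using funpow_in[of w i] P(2) by auto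
    qed
    show "(\<Union>i<n. A i) \<in> sets lborel"
      by (auto simp: A_def)
  qed (simp add: fmeasurable_def)
  finally show ?thesis by simp
qed

text \<open>The base has length at most \<open>1/n\<close> by \<open>tower_area\<close>. Slicing it
  into \<open>m + 1\<close> parts keeps one part with at least the average mass, and restricting the
  base preserves rigidity and disjointness.\<close>

lemma exists_thin_tower:
  assumes b: "b \<le> 1" and pos: "measure M {0..<b} > 0"
  obtains Q n where "is_interval Q" "Q \<subseteq> {0..<b}"
    "\<And>i x y. i < n \<Longrightarrow> x \<in> Q \<Longrightarrow> y \<in> Q \<Longrightarrow> (T ^^ i) y = (T ^^ i) x + (y - x)"
    "disjoint_family_on (\<lambda>i. (T ^^ i) ` Q) {..<n}"
    "\<And>x y. x \<in> Q \<Longrightarrow> y \<in> Q \<Longrightarrow> real n * \<bar>x - y\<bar> * real m < 1"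
    "1 / (2 * (real (card D) + 2) * (real m + 1)) \<le> real n * measure M Q"
proof -
  define K where "K = real (card D) + 2"
  have K: "K > 0" by (simp add: K_def)
  obtain P n where P: "is_interval P" "P \<subseteq> {0..<b}"
    and rigid: "\<And>i x y. i < n \<Longrightarrow> x \<in> P \<Longrightarrow> y \<in> P \<Longrightarrow> (T ^^ i) y = (T ^^ i) x + (y - x)"
    and disj: "disjoint_family_on (\<lambda>i. (T ^^ i) ` P) {..<n}"
    and big: "1 / (2 * K) \<le> real n * measure M P"
    using exists_tower[OF b pos] unfolding K_def by blast
  have "0 < real n * measure M P" using big K by (rule_tac less_le_trans) auto
  then have n: "n > 0" and P_ne: "P \<noteq> {}" by (auto simp: zero_less_mult_iff)
  have P01: "P \<subseteq> {0..<1}" using P(2) b by auto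
  \<comment> \<open>The scale is such that two points in one unit slice of \<open>g\<close> satisfy
    the required thinness. The values of \<open>g\<close> lie in \<open>[0,m]\<close>, and the slice
    \<open>q = m\<close> catches the end value \<open>m\<close>.\<close>
  define g where "g x = (x - Inf P) * real n * real m" for x
  define Q where "Q q = {x \<in> P. real q \<le> g x \<and> g x < real q + 1}" for q
  have g_mono: "g x \<le> g y" if "x \<le> y" for x y
    using that by (auto simp: g_def intro!: mult_right_mono)
  have Q_int: "is_interval (Q q)" for q
    using P(1) g_mono unfolding is_interval_1 Q_def
    by (smt (verit, best) mem_Collect_eq)
  have Q_sets: "Q q \<in> sets M" for q
    using real_interval_borel_measurable[OF Q_int] P01 by (auto simp: sets_M_iff Q_def)
  have "P \<subseteq> (\<Union>q\<in>{..m}. Q q)"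
  proof
    fix x assume x: "x \<in> P"
    have bdd: "bdd_below P" using P01 by (intro bdd_belowI[of _ 0]) auto
    have "x - 1 / real n \<le> Inf P"
    proof (rule cInf_greatest[OF P_ne])
      fix u assume u: "u \<in> P"
      show "x - 1 / real n \<le> u"
      proof (cases "u \<le> x")
        case True
        then show ?thesis
          using tower_area[OF P(1) P01 rigid disj u x True] n by (simp add: field_simps)
      next
        case False
        moreover have "0 \<le> 1 / real n" by simp
        ultimately show ?thesis by linarith
      qed
    qed
    then have "(x - Inf P) * real n \<le> 1" using n by (simp add: field_simps)
    then have le: "g x \<le> real m"
      unfolding g_def using mult_right_mono[of "(x - Inf P) * real n" 1 "real m"] by simp
    have ge: "0 \<le> g x" using cInf_lower[OF x bdd] by (simp add: g_def)
    define q where "q = nat \<lfloor>g x\<rfloor>"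
    have "real q \<le> g x" "g x < real q + 1"
      using ge by (auto simp: q_def)
    then have "x \<in> Q q" "q \<le> m" using x le by (auto simp: Q_def)
    then show "x \<in> (\<Union>q\<in>{..m}. Q q)" by blast
  qed
  then have "measure M P \<le> measure M (\<Union>q\<in>{..m}. Q q)"
    using Q_sets by (intro finite_measure_mono) auto
  also have "\<dots> \<le> (\<Sum>q\<in>{..m}. measure M (Q q))"
    using Q_sets by (intro finite_measure_subadditive_finite) auto
  finally have P_le: "measure M P \<le> (\<Sum>q\<in>{..m}. measure M (Q q))" .
  have "\<exists>q. measure M P / (real m + 1) \<le> measure M (Q q)"
  proof (rule ccontr)
    assume "\<not> ?thesis"
    then have "measure M (Q q) < measure M P / (real m + 1)" for q by (simp add: not_le)
    then have "(\<Sum>q\<in>{..m}. measure M (Q q)) < (\<Sum>q\<in>{..m}. measure M P / (real m + 1))"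
      by (intro sum_strict_mono) auto
    also have "\<dots> = measure M P" by (simp add: field_simps)
    finally show False using P_le by simp
  qed
  then obtain q where q: "measure M P / (real m + 1) \<le> measure M (Q q)" ..
  have sub: "Q q \<subseteq> P" by (auto simp: Q_def)
  show thesis
  proof (rule that[OF Q_int])
    show "Q q \<subseteq> {0..<b}" using sub P(2) by blast
    show "(T ^^ i) y = (T ^^ i) x + (y - x)" if "i < n" "x \<in> Q q" "y \<in> Q q" for i x y
      using rigid that sub by blast
    show "disjoint_family_on (\<lambda>i. (T ^^ i) ` Q q) {..<n}"
      using disj sub unfolding disjoint_family_on_def by blast
    show "real n * \<bar>x - y\<bar> * real m < 1" if "x \<in> Q q" "y \<in> Q q" for x y
    proof -
      have "\<bar>g x - g y\<bar> < 1" using that by (auto simp: Q_def)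
      moreover have "g x - g y = (x - y) * (real n * real m)" by (simp add: g_def algebra_simps)
      ultimately show ?thesis by (simp add: abs_mult ac_simps)
    qed
    have "1 / (2 * K * (real m + 1)) = 1 / (2 * K) / (real m + 1)" by simp
    also have "\<dots> \<le> real n * measure M P / (real m + 1)"
      using big by (intro divide_right_mono) auto
    also have "\<dots> = real n * (measure M P / (real m + 1))" by simp
    also have "\<dots> \<le> real n * measure M (Q q)"
      using q by (intro mult_left_mono) auto
    finally show "1 / (2 * (real (card D) + 2) * (real m + 1)) \<le> real n * measure M (Q q)"
      by (simp add: K_def)
  qed
qed

subsection \<open>Rectangles of mutually approaching points\<close>

text \<open>Without atoms the distribution function is continuous, so it takes every value between 0
  and 1. Capping \<open>e\<close> at 1 keeps the target in this range, and the closed end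
  \<open>b\<close> is a null set.\<close>

lemma exists_small_initial_segment:
  assumes nonatomic: "\<And>x. measure M {x} = 0" and e: "e > 0"
  obtains b where "b \<le> 1" "0 < measure M {0..<b}" "measure M {0..<b} \<le> e"
proof -
  define N where "N = distr M borel (\<lambda>x. x)"
  interpret N: real_distribution N
    unfolding N_def by (rule real_distribution_distr) simp
  have N_measure: "measure N A = measure M (A \<inter> {0..<1})" if "A \<in> sets borel" for A
    using that unfolding N_def by (subst measure_distr) (auto simp: space_M)
  have "measure N {x} = 0" for x
  proof -
    have "measure M ({x} \<inter> {0..<1}) = 0"
      using nonatomic[of x] by (cases "x \<in> {0..<1}") auto
    then show ?thesis by (simp add: N_measure)
  qed
  then have cont: "isCont (cdf N) x" for x
    by (simp add: N.isCont_cdf)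
  define e' where "e' = min e 1"
  have "cdf N (-1) = 0"
  proof -
    have "{..-1} \<inter> {0..<1::real} = {}" by auto
    then show ?thesis by (simp add: cdf_def N_measure)
  qed
  moreover have "cdf N 1 = 1"
  proof -
    have "{..1} \<inter> {0..<1} = space M" by (auto simp: space_M)
    then show ?thesis by (simp add: cdf_def N_measure prob_space)
  qed
  ultimately have "\<exists>x\<ge>-1. x \<le> 1 \<and> cdf N x = e'"
    using e cont by (intro IVT) (auto simp: e'_def)
  then obtain b where b: "b \<le> 1" "cdf N b = e'" by blast
  have "e' = measure M ({..b} \<inter> {0..<1})" using b by (simp add: cdf_def N_measure)
  then have eq: "measure M ({..b} \<inter> {0..<1}) = e'" by simp
  have "{0..<b} = {..b} \<inter> {0..<1} - {b}" using b by auto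
  moreover have "measure M ({..b} \<inter> {0..<1} - {b}) = e'"
  proof (cases "b \<in> {0..<1}")
    case True
    then show ?thesis
      using nonatomic[of b] eq by (subst finite_measure_Diff) (auto simp: sets_M_iff)
  qed (use eq in auto)
  ultimately have "measure M {0..<b} = e'" by simp
  with that b(1) e show thesis by (auto simp: e'_def)
qed

text \<open>The sets \<open>A\<close> and \<open>B\<close> are unions of levels from the first and
  the last third of a thin tower. The lower bounds on their measures do not involve
  \<open>N\<close>, which allows a limit over \<open>N\<close> later.\<close>

lemma exists_approaching_rectangle:
  assumes nonatomic: "\<And>x. measure M {x} = 0" and m: "m > 0"
  obtains A B where "A \<in> sets M" "B \<in> sets M"
    "1 / (12 * (real (card D) + 2) * (real m + 1)) \<le> measure M A"
    "1 / (12 * (real (card D) + 2) * (real m + 1)) \<le> measure M B"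
    "\<And>x y. x \<in> A \<Longrightarrow> y \<in> B \<Longrightarrow> \<exists>k\<ge>N. real k * \<bar>(T ^^ k) x - y\<bar> < 1 / real m"
proof -
  define h where "h = 1 / (2 * (real (card D) + 2) * (real m + 1))"
  have h: "h > 0" by (simp add: h_def)
  \<comment> \<open>A base of mass at most \<open>h / N'\<close> whose tower has mass at least
    \<open>h\<close> must have height at least \<open>3 * (N + 1)\<close>.\<close>
  define N' where "N' = real (3 * (N + 1))"
  have N': "N' > 0" by (simp add: N'_def)
  obtain b where b: "b \<le> 1" "0 < measure M {0..<b}" "measure M {0..<b} \<le> h / N'"
    using exists_small_initial_segment[OF nonatomic, of "h / N'"] h N' by auto
  obtain Q n where Q: "is_interval Q" "Q \<subseteq> {0..<b}"
    and rigid: "\<And>i x y. i < n \<Longrightarrow> x \<in> Q \<Longrightarrow> y \<in> Q \<Longrightarrow> (T ^^ i) y = (T ^^ i) x + (y - x)"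
    and disj: "disjoint_family_on (\<lambda>i. (T ^^ i) ` Q) {..<n}"
    and thin: "\<And>x y. x \<in> Q \<Longrightarrow> y \<in> Q \<Longrightarrow> real n * \<bar>x - y\<bar> * real m < 1"
    and big: "h \<le> real n * measure M Q"
    using exists_thin_tower[OF b(1,2), where m = m] unfolding h_def by blast
  have Q01: "Q \<subseteq> {0..<1}" using Q(2) b(1) by auto
  have "measure M Q \<le> h / N'"
    using finite_measure_mono[OF Q(2)] b by (auto simp: sets_M_iff)
  then have "h \<le> real n * (h / N')"
    using big by (meson mult_left_mono of_nat_0_le_iff order_trans)
  then have "N' \<le> real n" using h N' by (simp add: field_simps)
  then have n: "3 * (N + 1) \<le> n" unfolding N'_def by linarith
  define q where "q = n div 3"
  \<comment> \<open>Rounding in \<open>n div 3\<close> loses at most 2 levels; as \<open>q\<close>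
    is positive, \<open>q\<close> levels are still at least a sixth of the tower, hence the bound
    \<open>h / 6\<close>.\<close>
  have q: "N < q" "3 * q \<le> n" "n \<le> 6 * q" 
  proof -
    obtain t where t: "n = 3 * q + t" "t < 3"
      using that[of "n mod 3"] by (simp add: q_def)
    show "N < q" "3 * q \<le> n" using t n by auto
    then have "1 \<le> q" by linarith
    with t show "n \<le> 6 * q" by presburger
  qed
  have level: "(T ^^ i) ` Q \<in> sets M" "measure M ((T ^^ i) ` Q) = measure M Q" if "i < n" for i
    using interval_translate[OF Q(1) Q01 rigid[OF that]] by blast+
  define A where "A = (\<Union>i\<in>{..<q}. (T ^^ i) ` Q)"
  define B where "B = (\<Union>i\<in>{2*q..<3*q}. (T ^^ i) ` Q)"
  have lev: "(\<Union>i\<in>I. (T ^^ i) ` Q) \<in> sets M"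
    "h / 6 \<le> measure M (\<Union>i\<in>I. (T ^^ i) ` Q)" if "I \<subseteq> {..<n}" "card I = q" for I
  proof -
    have fin: "finite I" using that(1) finite_subset by blast
    then show "(\<Union>i\<in>I. (T ^^ i) ` Q) \<in> sets M"
      using that(1) level(1) by (intro sets.finite_UN) auto
    have "measure M (\<Union>i\<in>I. (T ^^ i) ` Q) = (\<Sum>i\<in>I. measure M ((T ^^ i) ` Q))"
      using that(1) level(1) fin disjoint_family_on_mono[OF that(1) disj]
      by (intro finite_measure_finite_Union) auto
    also have "\<dots> = (\<Sum>i\<in>I. measure M Q)"
      using that(1) level(2) by (intro sum.cong) auto
    also have "\<dots> = real q * measure M Q" using that(2) by simp
    finally have eq: "measure M (\<Union>i\<in>I. (T ^^ i) ` Q) = real q * measure M Q" .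
    have "real n * measure M Q \<le> real (6 * q) * measure M Q"
      using q(3) by (intro mult_right_mono) (auto simp del: of_nat_mult)
    then show "h / 6 \<le> measure M (\<Union>i\<in>I. (T ^^ i) ` Q)"
      using big eq by simp
  qed
  have A: "A \<in> sets M" "h / 6 \<le> measure M A"
    unfolding A_def using q by (intro lev; auto)+
  have B: "B \<in> sets M" "h / 6 \<le> measure M B"
    unfolding B_def using q by (intro lev; auto)+
  have "\<exists>k\<ge>N. real k * \<bar>(T ^^ k) x - y\<bar> < 1 / real m" if xy: "x \<in> A" "y \<in> B" for x y
  proof -
    obtain i u where i: "i < q" "u \<in> Q" "x = (T ^^ i) u" using xy by (auto simp: A_def)
    obtain j v where j: "2 * q \<le> j" "j < 3 * q" "v \<in> Q" "y = (T ^^ j) v" using xy by (auto simp: B_def)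
    define k where "k = j - i"
    \<comment> \<open>Since \<open>i < q\<close> and \<open>2 * q \<le> j\<close>, the delay
      \<open>k\<close> exceeds \<open>q\<close> and hence \<open>N\<close>. After \<open>k\<close>
      steps \<open>x\<close> lies in the level of \<open>y\<close>, and their distance is that of
      \<open>u\<close> and \<open>v\<close> in the base.\<close>
    have k: "N \<le> k" "k \<le> n" "j = k + i" "j < n" using i j q by (auto simp: k_def)
    have "(T ^^ k) x - y = u - v"
      using rigid[OF k(4) i(2) j(3)] i j k(3) by (simp add: funpow_add)
    moreover have "real k * \<bar>u - v\<bar> * real m \<le> real n * \<bar>u - v\<bar> * real m"
      using k(2) by (intro mult_right_mono) auto
    ultimately have "real k * \<bar>(T ^^ k) x - y\<bar> * real m < 1"
      using thin[OF i(2) j(3)] by simp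
    then have "real k * \<bar>(T ^^ k) x - y\<bar> < 1 / real m"
      using m by (simp add: field_simps)
    with k(1) show ?thesis by blast
  qed
  moreover have "1 / (12 * (real (card D) + 2) * (real m + 1)) = h / 6"
    by (simp add: h_def)
  ultimately show thesis using that A B by metis
qed

subsection \<open>The zero-one law\<close>

definition approach :: "real \<Rightarrow> real \<Rightarrow> ereal" where
  "approach x y = liminf (\<lambda>n. ereal (real n * \<bar>(T ^^ n) x - y\<bar>))"

lemma approach_measurable [measurable]:
  "(\<lambda>z. approach (fst z) (snd z)) \<in> borel_measurable (M \<Otimes>\<^sub>M M)"
proof -
  have [measurable]: "(\<lambda>x. (T ^^ n) x) \<in> borel_measurable M" for n
    using measurable_compose[OF funpow_measurable id_borel_measurable] .
  have [measurable]: "fst \<in> measurable (M \<Otimes>\<^sub>M M) M" "snd \<in> borel_measurable (M \<Otimes>\<^sub>M M)"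
    using measurable_compose[OF measurable_snd id_borel_measurable] by auto
  show ?thesis unfolding approach_def by measurable
qed

lemma approach_nonneg: "0 \<le> approach x y"
  unfolding approach_def by (intro Liminf_bounded) auto

text \<open>This negates the characterisation of lower bounds for a liminf. The gap between
  \<open>e\<close> and \<open>c\<close> leaves room to absorb errors when the time is
  shifted.\<close>

lemma approach_less_iff:
  "approach x y < ereal c \<longleftrightarrow> (\<exists>e<c. \<exists>\<^sub>F k in sequentially. real k * \<bar>(T ^^ k) x - y\<bar> \<le> e)"
proof -
  have "\<not> approach x y < ereal c \<longleftrightarrow>
      (\<forall>e<ereal c. \<forall>\<^sub>F k in sequentially. e < ereal (real k * \<bar>(T ^^ k) x - y\<bar>))"
    unfolding not_less approach_def le_Liminf_iff ..
  also have "\<dots> \<longleftrightarrow> (\<forall>e<c. \<forall>\<^sub>F k in sequentially. e < real k * \<bar>(T ^^ k) x - y\<bar>)"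
  proof (intro iffI allI impI)
    fix e assume *: "\<forall>e<c. \<forall>\<^sub>F k in sequentially. e < real k * \<bar>(T ^^ k) x - y\<bar>" and e: "e < ereal c"
    then show "\<forall>\<^sub>F k in sequentially. e < ereal (real k * \<bar>(T ^^ k) x - y\<bar>)"
      by (cases e) auto
  next
    fix e assume *: "\<forall>e<ereal c. \<forall>\<^sub>F k in sequentially. e < ereal (real k * \<bar>(T ^^ k) x - y\<bar>)" and e: "e < c"
    then show "\<forall>\<^sub>F k in sequentially. e < real k * \<bar>(T ^^ k) x - y\<bar>"
      using *[rule_format, of "ereal e"] by simp
  qed
  finally show ?thesis
    by (auto simp: frequently_def not_le)
qed

text \<open>Starting from \<open>T x\<close> reads the same orbit one step later with the smaller
  weight \<open>n\<close> in place of \<open>n + 1\<close>.\<close>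

lemma approach_fst_step: "approach (T x) y \<le> approach x y"
proof -
  define g where "g n = ereal (real n * \<bar>(T ^^ n) x - y\<bar>)" for n
  have "approach (T x) y \<le> liminf (\<lambda>n. g (n + 1))"
    unfolding approach_def g_def
    by (intro Liminf_mono always_eventually allI) (simp add: funpow_swap1 mult_right_mono)
  also have "\<dots> = approach x y"
    unfolding approach_def g_def[symmetric] by (rule liminf_shift[of g, unfolded Suc_eq_plus1])
  finally show ?thesis .
qed

text \<open>Away from the break points \<open>T\<close> is an isometry near \<open>y\<close>, so a
  close approach to \<open>y\<close> at a large time \<open>k\<close> becomes an equally close
  approach to \<open>T y\<close> at time \<open>k + 1\<close>. The weight grows by one, which adds
  only the small distance itself.\<close>

lemma approach_snd_step:
  assumes x: "x \<in> {0..<1}" and y: "y \<in> {0..<1}" "y \<notin> D"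
  shows "approach x (T y) \<le> approach x y"
proof (rule dense_ge)
  fix c' assume c': "approach x y < c'"
  show "approach x (T y) \<le> c'"
  proof (cases c')
    case (real c)
    with c' obtain e where e: "e < c"
      and freq: "\<exists>\<^sub>F k in sequentially. real k * \<bar>(T ^^ k) x - y\<bar> \<le> e"
      using approach_less_iff by blast
    have "\<exists>d>0. \<forall>z\<in>D. d \<le> dist y z"
      using finite_set_avoid[OF finite_D, of y] y(2) by (metis)
    then obtain d where d: "d > 0" "\<And>z. z \<in> D \<Longrightarrow> d \<le> \<bar>y - z\<bar>"
      by (auto simp: dist_real_def)
    have near: "\<bar>T z - T y\<bar> = \<bar>z - y\<bar>" if "z \<in> {0..<1}" "\<bar>z - y\<bar> < d" for z
    proof (cases "z \<le> y")
      case True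
      have "D \<inter> {z<..y} = {}" using d(2) that by force
      then show ?thesis using translation[of z y] True that y by auto
    next
      case False
      have "D \<inter> {y<..z} = {}" using d(2) that by force
      then show ?thesis using translation[of y z] False that y by auto
    qed
    \<comment> \<open>The bound \<open>d\<close> keeps the orbit point in the isometric
      neighbourhood of \<open>y\<close>, and \<open>c - e\<close> bounds the extra term from raising
      the weight to \<open>k + 1\<close>.\<close>
    define r where "r = min (c - e) d"
    have r: "r > 0" using e d by (simp add: r_def)
    obtain K :: nat where K: "\<bar>e\<bar> / r < real K" using reals_Archimedean2 by blast
    have "\<exists>\<^sub>F k in sequentially. real k * \<bar>(T ^^ k) x - y\<bar> \<le> e \<and> K < k"
      using freq eventually_gt_at_top[of K] by (rule frequently_eventually_frequently)
    then have "\<exists>\<^sub>F k in sequentially. real (Suc k) * \<bar>(T ^^ Suc k) x - T y\<bar> \<le> c"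
    proof (rule frequently_elim1)
      fix k assume k: "real k * \<bar>(T ^^ k) x - y\<bar> \<le> e \<and> K < k"
      have "\<bar>e\<bar> < r * real k"
        using K k r by (simp add: field_simps) (metis less_trans mult_less_cancel_left_pos of_nat_less_iff)
      then have "real k * \<bar>(T ^^ k) x - y\<bar> < real k * r"
        using k unfolding mult.commute[of r] by linarith
      then have small: "\<bar>(T ^^ k) x - y\<bar> < r"
        by (rule mult_left_less_imp_less) simp
      then have "\<bar>(T ^^ Suc k) x - T y\<bar> = \<bar>(T ^^ k) x - y\<bar>"
        using near[OF funpow_in[OF x]] by (simp add: r_def)
      then show "real (Suc k) * \<bar>(T ^^ Suc k) x - T y\<bar> \<le> c"
        using k small by (simp add: algebra_simps r_def)
    qed
    then have "\<exists>\<^sub>F k in sequentially. real k * \<bar>(T ^^ k) x - T y\<bar> \<le> c"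
      unfolding frequently_def eventually_sequentially
      by (metis le_SucI)
    then have "approach x (T y) < ereal (c + e')" if "e' > 0" for e'
      unfolding approach_less_iff using that by (intro exI[of _ c]) auto
    then have "approach x (T y) \<le> ereal c"
      by - (rule ereal_le_epsilon2, simp add: less_imp_le)
    then show ?thesis using real by simp
  qed (use c' in auto)
qed

text \<open>The rectangles show that the sublevel set \<open>F\<close> has positive product measure.
  Ergodicity is then used once in each coordinate: every fibre \<open>G y\<close> is null or full,
  and the set \<open>Y\<close> of those \<open>y\<close> with full fibre is null or full. Fubini
  excludes the null case.\<close>

lemma approach_AE_le:
  assumes nonatomic: "\<And>x. measure M {x} = 0" and m: "m > 0"
  shows "AE z in M \<Otimes>\<^sub>M M. approach (fst z) (snd z) \<le> ereal (1 / real m)"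
proof -
  interpret P: pair_prob_space M M ..
  have [measurable]: "(\<lambda>x. (T ^^ n) x) \<in> borel_measurable M" for n
    using measurable_compose[OF funpow_measurable id_borel_measurable] .
  have [measurable]: "fst \<in> measurable (M \<Otimes>\<^sub>M M) M" "snd \<in> borel_measurable (M \<Otimes>\<^sub>M M)"
    using measurable_compose[OF measurable_snd id_borel_measurable] by auto
  define d where "d = 1 / (12 * (real (card D) + 2) * (real m + 1))"
  have d: "d > 0" by (simp add: d_def)
  define F where "F = {z \<in> space (M \<Otimes>\<^sub>M M). approach (fst z) (snd z) \<le> ereal (1 / real m)}"
  have F_sets [measurable]: "F \<in> sets (M \<Otimes>\<^sub>M M)"
    unfolding F_def by measurable
  define W where "W N = {z \<in> space (M \<Otimes>\<^sub>M M).
    \<exists>k\<ge>N. real k * \<bar>(T ^^ k) (fst z) - snd z\<bar> < 1 / real m}" for N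
  have W_sets [measurable]: "W N \<in> sets (M \<Otimes>\<^sub>M M)" for N
    unfolding W_def by measurable
  have W_large: "d * d \<le> P.prob (W N)" for N
  proof -
    obtain A B where AB: "A \<in> sets M" "B \<in> sets M" "d \<le> measure M A" "d \<le> measure M B"
      and close: "\<And>x y. x \<in> A \<Longrightarrow> y \<in> B \<Longrightarrow> \<exists>k\<ge>N. real k * \<bar>(T ^^ k) x - y\<bar> < 1 / real m"
      using exists_approaching_rectangle[OF nonatomic m, of N] unfolding d_def by blast
    have "d * d \<le> measure M A * measure M B"
      using AB d by (intro mult_mono) auto
    also have "\<dots> = P.prob (A \<times> B)"
      unfolding measure_def emeasure_pair_measure_Times[OF AB(1,2)] enn2real_mult ..
    also have "\<dots> \<le> P.prob (W N)"
      using AB close sets.sets_into_space[OF AB(1)] sets.sets_into_space[OF AB(2)]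
      by (intro P.finite_measure_mono) (auto simp: W_def space_pair_measure)
    finally show ?thesis .
  qed
  \<comment> \<open>The sets \<open>W N\<close> decrease and all have measure at least
    \<open>d * d\<close>, so their intersection does too.\<close>
  have "(\<lambda>N. P.prob (W N)) \<longlonglongrightarrow> P.prob (\<Inter>N. W N)"
    by (intro P.finite_Lim_measure_decseq) (auto simp: decseq_def W_def intro: order_trans)
  then have "d * d \<le> P.prob (\<Inter>N. W N)"
    using W_large by (intro LIMSEQ_le_const) auto
  also have "(\<Inter>N. W N) \<subseteq> F"
  proof
    fix z assume z: "z \<in> (\<Inter>N. W N)"
    then have "\<exists>\<^sub>F k in sequentially. real k * \<bar>(T ^^ k) (fst z) - snd z\<bar> \<le> 1 / real m"
      unfolding frequently_def eventually_sequentially W_def by force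
    then have "approach (fst z) (snd z) < ereal (1 / real m + e)" if "e > 0" for e
      unfolding approach_less_iff using that by (intro exI[of _ "1 / real m"]) auto
    then have "approach (fst z) (snd z) \<le> ereal (1 / real m)"
      by - (rule ereal_le_epsilon2, simp add: less_imp_le)
    then show "z \<in> F" using z by (auto simp: F_def W_def)
  qed
  then have "P.prob (\<Inter>N. W N) \<le> P.prob F"
    by (intro P.finite_measure_mono) auto
  finally have F_pos: "P.prob F > 0" using d by (smt (verit) mult_pos_pos)
  define G where "G y = (\<lambda>x. (x, y)) -` F" for y
  have G_sets [measurable]: "G y \<in> sets M" for y
    unfolding G_def by (rule sets_Pair2) measurable
  have G_iff: "x \<in> G y \<longleftrightarrow> x \<in> space M \<and> y \<in> space M \<and> approach x y \<le> ereal (1 / real m)" for x y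
    by (auto simp: G_def F_def space_pair_measure)
  have G01: "measure M (G y) = 0 \<or> measure M (G y) = 1" for y
  proof -
    have "T x \<in> G y" if "x \<in> G y" for x
      using that approach_fst_step[of x y] measurable_space[OF T_measurable]
      by (auto simp: G_iff intro: order_trans)
    then show ?thesis
      using forward_invariant_imp_full[OF G_sets[of y]]
      by (cases "measure M (G y) = 0") (auto simp: zero_less_measure_iff)
  qed
  have G_meas [measurable]: "(\<lambda>y. measure M (G y)) \<in> borel_measurable M"
    unfolding measure_def G_def using P.measurable_emeasure_Pair2[OF F_sets] by measurable
  define Y where "Y = {y \<in> space M. measure M (G y) = 1}"
  have Y_sets [measurable]: "Y \<in> sets M"
    unfolding Y_def by measurable
  have F_eq: "emeasure (M \<Otimes>\<^sub>M M) F = (\<integral>\<^sup>+y. emeasure M (G y) \<partial>M)"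
    unfolding G_def by (rule P.emeasure_pair_measure_alt2[OF F_sets])
  have "measure M Y \<noteq> 0"
  proof
    assume "measure M Y = 0"
    then have "AE y in M. y \<notin> Y"
      by (simp add: AE_iff_null_sets[OF Y_sets, symmetric] emeasure_eq_measure null_sets_def)
    then have "AE y in M. emeasure M (G y) = 0"
      using AE_space by eventually_elim (use G01 in \<open>auto simp: Y_def emeasure_eq_measure\<close>)
    then have "emeasure (M \<Otimes>\<^sub>M M) F = 0"
      unfolding F_eq by (subst nn_integral_cong_AE[where v = "\<lambda>_. 0"]) auto
    with F_pos show False by (simp add: P.emeasure_eq_measure)
  qed
  \<comment> \<open>The step in the second variable fails only on the finite set \<open>D\<close>,
    which is null because there are no atoms.\<close>
  moreover have "AE y in M. y \<in> Y \<longrightarrow> T y \<in> Y"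
  proof -
    have "AE y in M. y \<noteq> e" for e
    proof (cases "e \<in> space M")
      case True
      then have "{e} \<in> null_sets M"
        using nonatomic[of e] by (auto simp: null_sets_def emeasure_eq_measure sets_M_iff space_M)
      then show ?thesis by (rule AE_I'[of "{e}"]) auto
    next
      case False
      then show ?thesis using AE_space by (auto elim: eventually_mono)
    qed
    then have "AE y in M. \<forall>e\<in>D. y \<noteq> e"
      using finite_D by (simp add: AE_finite_all)
    then show ?thesis
    proof eventually_elim
      case (elim y)
      show ?case
      proof
        assume y: "y \<in> Y"
        then have y01: "y \<in> {0..<1}" by (simp add: Y_def space_M)
        have Ty: "T y \<in> space M"
          using measurable_space[OF T_measurable] y by (simp add: Y_def)
        have "x \<in> G (T y)" if "x \<in> G y" for x
        proof -
          have "approach x (T y) \<le> approach x y"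
            using that elim y01 by (intro approach_snd_step) (auto simp: G_iff space_M)
          then show ?thesis using that Ty by (auto simp: G_iff intro: order_trans)
        qed
        then have "measure M (G y) \<le> measure M (G (T y))"
          by (intro finite_measure_mono) auto
        then show "T y \<in> Y" using y Ty G01[of "T y"] by (auto simp: Y_def)
      qed
    qed
  qed
  ultimately have "measure M Y = 1"
    using forward_invariant_imp_full[OF Y_sets] by (simp add: zero_less_measure_iff)
  then have "AE y in M. y \<in> Y"
    using prob_eq_1[OF Y_sets] by simp
  then have "AE y in M. emeasure M (G y) = 1"
    by eventually_elim (simp add: Y_def emeasure_eq_measure)
  then have "emeasure (M \<Otimes>\<^sub>M M) F = 1"
    unfolding F_eq by (subst nn_integral_cong_AE[where v = "\<lambda>_. 1"]) (auto simp: emeasure_space_1)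
  then have "P.prob F = 1" by (simp add: P.emeasure_eq_measure)
  then have "AE z in M \<Otimes>\<^sub>M M. z \<in> F"
    using P.prob_eq_1[OF F_sets] by simp
  then show ?thesis
    by eventually_elim (simp add: F_def)
qed

subsection \<open>Measures with an atom\<close>

text \<open>Every point of the forward orbit has at least the mass of \<open>z\<close>, so a finite
  measure leaves no room for infinitely many distinct ones. Injectivity turns a coincidence on the
  orbit into a return to \<open>z\<close>.\<close>

lemma atom_periodic:
  assumes z: "measure M {z} > 0"
  obtains p where "p > 0" "(T ^^ p) z = z"
proof -
  have sing: "{z} \<in> sets M" using z measure_notin_sets by fastforce
  then have z01: "z \<in> {0..<1}" by (simp add: sets_M_iff)
  have level_sets: "{(T ^^ n) z} \<in> sets M" for n
    using funpow_in[OF z01] by (simp add: sets_M_iff)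
  have mono: "measure M {z} \<le> measure M {(T ^^ n) z}" for n
  proof -
    have "measure M {z} \<le> measure M ((T ^^ n) -` {(T ^^ n) z} \<inter> space M)"
      using z01 measurable_sets[OF funpow_measurable level_sets]
      by (intro finite_measure_mono) (auto simp: space_M)
    then show ?thesis using measure_vimage_funpow[OF level_sets] by simp
  qed
  have "\<not> inj (\<lambda>n. (T ^^ n) z)"
  proof
    assume inj: "inj (\<lambda>n. (T ^^ n) z)"
    obtain N :: nat where N: "1 / measure M {z} < real N" using reals_Archimedean2 by blast
    have "1 < real N * measure M {z}" using N z by (simp add: field_simps)
    also have "\<dots> = (\<Sum>n<N. measure M {z})" by simp
    also have "\<dots> \<le> (\<Sum>n<N. measure M {(T ^^ n) z})" by (intro sum_mono mono)
    also have "\<dots> = measure M (\<Union>n<N. {(T ^^ n) z})"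
      using level_sets inj
      by (intro finite_measure_finite_Union[symmetric]) (auto simp: disjoint_family_on_def inj_def)
    also have "\<dots> \<le> 1" by (rule prob_le_1)
    finally show False by simp
  qed
  then obtain i j where ij: "i < j" "(T ^^ i) z = (T ^^ j) z"
    unfolding inj_def by (metis linorder_neqE_nat)
  show thesis
    using that[of "j - i"] ij funpow_cancel[OF z01 z01 ij(2)] by simp
qed

text \<open>The periodic orbit of the atom is forward invariant, hence of full measure, and each of
  its points hits every other one exactly at arbitrarily late times.\<close>

lemma approach_AE_zero_atomic:
  assumes z: "measure M {z} > 0"
  shows "AE w in M \<Otimes>\<^sub>M M. approach (fst w) (snd w) = 0"
proof -
  obtain p where p: "p > 0" "(T ^^ p) z = z" using atom_periodic[OF z] .
  have "{z} \<in> sets M" using z measure_notin_sets by fastforce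
  then have z01: "z \<in> {0..<1}" by (simp add: sets_M_iff)
  define orb where "orb = (\<Union>n. {(T ^^ n) z})"
  have orb_sets: "orb \<in> sets M"
    unfolding orb_def using funpow_in[OF z01] by (intro sets.countable_UN) (auto simp: sets_M_iff)
  have "measure M {z} \<le> measure M orb"
    using orb_sets by (intro finite_measure_mono) (auto simp: orb_def intro: exI[of _ 0])
  moreover have "T x \<in> orb" if "x \<in> orb" for x
  proof -
    from that obtain n where "x = (T ^^ n) z" by (auto simp: orb_def)
    then have "T x = (T ^^ Suc n) z" by simp
    then show ?thesis unfolding orb_def by blast
  qed
  ultimately have "measure M orb = 1"
    using forward_invariant_imp_full[OF orb_sets] z by simp
  then have "measure (M \<Otimes>\<^sub>M M) (orb \<times> orb) = 1"
    using orb_sets by (simp add: measure_def emeasure_pair_measure_Times enn2real_mult)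
  moreover interpret P: pair_prob_space M M ..
  have "orb \<times> orb \<in> sets (M \<Otimes>\<^sub>M M)" using orb_sets by simp
  ultimately have "AE w in M \<Otimes>\<^sub>M M. w \<in> orb \<times> orb"
    using P.prob_eq_1 by blast
  then show ?thesis
  proof eventually_elim
    case (elim w)
    then obtain i j where ij: "fst w = (T ^^ i) z" "snd w = (T ^^ j) z"
      by (auto simp: orb_def)
    have "\<exists>\<^sub>F k in sequentially. real k * \<bar>(T ^^ k) (fst w) - snd w\<bar> \<le> 0"
      unfolding frequently_def eventually_sequentially
    proof (clarify, goal_cases)
      case (1 N)
      \<comment> \<open>Chosen so that \<open>k + i = j + (i + N) * p\<close>, which is
        \<open>j\<close> modulo the period; the term \<open>N * p\<close> makes \<open>k\<close> at
        least \<open>N\<close>.\<close>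
      define k where "k = j + i * (p - 1) + N * p"
      have "N \<le> N * p" using p(1) by simp
      then have "N \<le> k" unfolding k_def by (rule trans_le_add2)
      have "k + i = j + (i + N) * p"
        using p(1) by (cases p) (simp_all add: k_def algebra_simps)
      then have "(k + i) mod p = j mod p" by simp
      then have "(T ^^ (k + i)) z = (T ^^ j) z"
        using funpow_mod_eq[OF p(2)] by metis
      then have "(T ^^ k) (fst w) = snd w"
        by (simp add: ij funpow_add)
      with 1 \<open>N \<le> k\<close> show False by auto
    qed
    then have "approach (fst w) (snd w) < ereal (0 + e)" if "e > 0" for e
      unfolding approach_less_iff using that by (intro exI[of _ 0]) auto
    then have "approach (fst w) (snd w) \<le> ereal 0"
      by - (rule ereal_le_epsilon2, simp add: less_imp_le)
    then show ?case
      using approach_nonneg by (simp add: order_antisym zero_ereal_def)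
  qed
qed

theorem approach_AE_zero: "AE z in M \<Otimes>\<^sub>M M. approach (fst z) (snd z) = 0"
proof (cases "\<exists>z. measure M {z} > 0")
  case True
  then show ?thesis using approach_AE_zero_atomic by blast
next
  case False
  then have nonatomic: "measure M {x} = 0" for x by (simp add: zero_less_measure_iff)
  have "AE z in M \<Otimes>\<^sub>M M. \<forall>m. approach (fst z) (snd z) \<le> ereal (1 / real (Suc m))"
    by (subst AE_all_countable) (intro allI approach_AE_le nonatomic, simp)
  then show ?thesis
  proof eventually_elim
    case (elim z)
    have "(\<lambda>m. ereal (1 / real (Suc m))) \<longlonglongrightarrow> ereal 0"
      by (intro tendsto_ereal) (rule LIMSEQ_inverse_real_of_nat[unfolded inverse_eq_divide])
    then have "approach (fst z) (snd z) \<le> ereal 0"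
      by (rule LIMSEQ_le_const) (use elim in blast)
    then show ?case
      using approach_nonneg by (simp add: order_antisym zero_ereal_def)
  qed
qed

end

subsection \<open>Interval exchange transformations\<close>

lemma iet_s_Suc: "iet_s l (Suc k) = iet_s l k + l (Suc k)"
  by (simp add: iet_s_def)

lemma iet_s_mono:
  assumes "is_iet r p l" "i \<le> j" "j \<le> r"
  shows "iet_s l i \<le> iet_s l j"
  unfolding iet_s_def using assms by (intro sum_mono2) (auto simp: is_iet_def intro: less_imp_le)

lemma iet_interval_unique:
  assumes iet: "is_iet r p l" and k: "k \<in> {1..r}" "iet_s l (k - 1) \<le> x" "x < iet_s l k"
    and k': "k' \<in> {1..r}" "iet_s l (k' - 1) \<le> x" "x < iet_s l k'"
  shows "k' = k"
proof (rule ccontr)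
  assume "k' \<noteq> k"
  then consider "k \<le> k' - 1" | "k' \<le> k - 1" by linarith
  then show False
  proof cases
    case 1
    have "iet_s l k \<le> iet_s l (k' - 1)" using iet_s_mono[OF iet 1] k'(1) by force
    then show False using k k' by simp
  next
    case 2
    have "iet_s l k' \<le> iet_s l (k - 1)" using iet_s_mono[OF iet 2] k(1) by force
    then show False using k k' by simp
  qed
qed

lemma iet_interval_exists:
  assumes iet: "is_iet r p l" and x: "x \<in> {0..<1}"
  obtains k where "k \<in> {1..r}" "iet_s l (k - 1) \<le> x" "x < iet_s l k"
proof -
  have r: "x < iet_s l r" using iet x by (simp add: is_iet_def iet_s_def)
  define k where "k = (LEAST k. x < iet_s l k)"
  have k: "x < iet_s l k" "k \<le> r"
    unfolding k_def using r by (auto intro: LeastI Least_le)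
  have "k \<noteq> 0" using k(1) x by (cases "k = 0") (auto simp: iet_s_def)
  then have "\<not> x < iet_s l (k - 1)"
    using not_less_Least[of "k - 1" "\<lambda>k. x < iet_s l k"] unfolding k_def[symmetric] by simp
  with k \<open>k \<noteq> 0\<close> show thesis by (intro that[of k]) auto
qed

lemma iet_map_eq:
  assumes iet: "is_iet r p l" and k: "k \<in> {1..r}" "iet_s l (k - 1) \<le> x" "x < iet_s l k"
  shows "iet_map r p l x = x - iet_s l (k - 1) + (\<Sum>i\<in>{i\<in>{1..r}. p i < p k}. l i)"
proof -
  have "(THE k. k \<in> {1..r} \<and> iet_s l (k - 1) \<le> x \<and> x < iet_s l k) = k"
  proof (rule the_equality)
    fix k' assume "k' \<in> {1..r} \<and> iet_s l (k' - 1) \<le> x \<and> x < iet_s l k'"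
    then show "k' = k" using iet_interval_unique[OF iet k] by blast
  qed (use k in blast)
  moreover have "\<exists>k\<in>{1..r}. iet_s l (k - 1) \<le> x \<and> x < iet_s l k"
    using k by blast
  ultimately show ?thesis unfolding iet_map_def Let_def by (simp only: if_True)
qed

text \<open>With no end point in \<open>{u<..v}\<close> both points lie in the same exchanged
  interval, where \<open>iet_map\<close> adds one constant.\<close>

lemma iet_map_translation:
  assumes iet: "is_iet r p l" and uv: "0 \<le> u" "u \<le> v" "v < 1"
    and free: "iet_s l ` {1..r} \<inter> {u<..v} = {}"
  shows "iet_map r p l v = iet_map r p l u + (v - u)"
proof -
  obtain k where k: "k \<in> {1..r}" "iet_s l (k - 1) \<le> u" "u < iet_s l k"
    using iet_interval_exists[OF iet, of u] uv by auto
  then have "iet_s l k \<notin> {u<..v}" using free by blast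
  then have "v < iet_s l k" using k by simp
  then show ?thesis
    using iet_map_eq[OF iet k] iet_map_eq[OF iet k(1), of v] k uv by simp
qed

text \<open>The image of the \<open>k\<close>-th interval ends where the total length of the
  intervals placed up to and including \<open>k\<close> is used up. This is at most the offset of
  any interval placed later.\<close>

lemma iet_map_separated:
  assumes iet: "is_iet r p l"
    and k: "k \<in> {1..r}" "iet_s l (k - 1) \<le> x" "x < iet_s l k"
    and k': "k' \<in> {1..r}" "iet_s l (k' - 1) \<le> y" "y < iet_s l k'"
    and less: "p k < p k'"
  shows "iet_map r p l x < iet_map r p l y"
proof -
  have "iet_s l k = iet_s l (k - 1) + l k"
    using k(1) iet_s_Suc[of l "k - 1"] by simp
  then have "iet_map r p l x < l k + (\<Sum>i\<in>{i\<in>{1..r}. p i < p k}. l i)"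
    using iet_map_eq[OF iet k] k by simp
  also have "\<dots> = (\<Sum>i\<in>insert k {i\<in>{1..r}. p i < p k}. l i)" by simp
  also have "\<dots> \<le> (\<Sum>i\<in>{i\<in>{1..r}. p i < p k'}. l i)"
    using k(1) less iet by (intro sum_mono2) (auto simp: is_iet_def intro: less_imp_le)
  also have "\<dots> \<le> iet_map r p l y"
    using iet_map_eq[OF iet k'] k' by simp
  finally show ?thesis .
qed

lemma inj_on_iet_map:
  assumes iet: "is_iet r p l"
  shows "inj_on (iet_map r p l) {0..<1}"
proof (rule inj_onI)
  fix x y assume x: "x \<in> {0..<1}" and y: "y \<in> {0..<1}" and eq: "iet_map r p l x = iet_map r p l y"
  obtain k where k: "k \<in> {1..r}" "iet_s l (k - 1) \<le> x" "x < iet_s l k"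
    using iet_interval_exists[OF iet x] .
  obtain k' where k': "k' \<in> {1..r}" "iet_s l (k' - 1) \<le> y" "y < iet_s l k'"
    using iet_interval_exists[OF iet y] .
  have "\<not> p k < p k'" "\<not> p k' < p k"
    using iet_map_separated[OF iet k k'] iet_map_separated[OF iet k' k] eq by auto
  then have "p k = p k'" by simp
  moreover have "inj p" using iet by (auto simp: is_iet_def permutes_inj)
  ultimately have "k = k'" by (simp add: inj_eq)
  then show "x = y" using iet_map_eq[OF iet k] iet_map_eq[OF iet k'] eq
    unfolding \<open>k = k'\<close> by linarith
qed

theorem theorem4p1:
  fixes r :: nat and p :: "nat \<Rightarrow> nat" and l :: "nat \<Rightarrow> real" and \<mu> :: "real measure"
  assumes "is_iet r p l"
    and "prob_space \<mu>"
    and "sets \<mu> = sets (restrict_space borel {0..<1::real})"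
    and "invariant_measure \<mu> (iet_map r p l)"
    and "ergodic_measure \<mu> (iet_map r p l)"
  shows "AE z in \<mu> \<Otimes>\<^sub>M \<mu>.
           liminf (\<lambda>n. ereal (real n * \<bar>(iet_map r p l ^^ n) (fst z) - snd z\<bar>)) = 0"
proof -
  interpret ergodic_piecewise_translation \<mu> "iet_map r p l" "iet_s l ` {1..r}"
  proof (intro ergodic_piecewise_translation.intro ergodic_piecewise_translation_axioms.intro)
    show "inj_on (iet_map r p l) {0..<1}"
      by (rule inj_on_iet_map[OF assms(1)])
    show "iet_map r p l v = iet_map r p l u + (v - u)"
      if "0 \<le> u" "u \<le> v" "v < 1" "iet_s l ` {1..r} \<inter> {u<..v} = {}" for u v
      by (rule iet_map_translation[OF assms(1) that])
  qed (use assms in simp_all)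
  show ?thesis
    using approach_AE_zero unfolding approach_def .
qed

end
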